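(* Let $0<A<B$ be real numbers. There is a constant $K=K(A,B)>0$ such that for every integer $N\ge 2$ and every real $N'$ with $N<N'\leqslant 2N$ there exists a point $C\in[A,B]$ with $$ |S(C,N)| \leqslant K\, N^{2/3}\log^{9/2}N , $$ where $$ S(\alpha,N) := \sum_{N<n\leqslant N'} d_3(n)\, e^{i\alpha n^{2/3}}\qquad(\alpha\in\mathbb{R}). $$
   Context: $d_3(n)=\sum_{k\ell m=n}1$ ($k,\ell,m,n\in\mathbb{N}$) is the ternary divisor function, i.e. the number of ordered factorizations of $n$ into three positive integers (the coefficients of $\zeta^3(s)$ for $\Re s>1$). The sum $S(\alpha,N)$ depends also on the upper endpoint $N'$ ($N<N'\leqslant 2N$), and the point $C$ may depend on $N$ and $N'$. *)

theory Defs
  imports "HOL-Analysis.Analysis"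
begin

definition d3 :: "nat \<Rightarrow> nat" where
  "d3 n = card {(k, l, m). 0 < k \<and> 0 < l \<and> 0 < m \<and> k * l * m = n}"

(* The upper endpoint N' is real, so it is an explicit argument. *)
definition S :: "real \<Rightarrow> nat \<Rightarrow> real \<Rightarrow> complex" where
  "S \<alpha> N N' = (\<Sum>n | N < n \<and> real n \<le> N'.
     of_nat (d3 n) * exp (\<i> * complex_of_real (\<alpha> * real n powr (2/3))))"

end

theory Submission
  imports Defs
begin

text \<open>
  The mean square of \<open>S(\<alpha>, N)\<close> over \<open>[A, B]\<close> is attained at some point \<open>C\<close>.  Expanding it, the
  diagonal contributes \<open>(B - A) \<Sum> d\<^sub>3(n)\<^sup>2\<close>, and each off-diagonal pair contributes at most
  \<open>2 d\<^sub>3(m) d\<^sub>3(n) / \<bar>m\<^bsup>2/3\<^esup> - n\<^bsup>2/3\<^esup>\<bar>\<close>, so that by AM-GM and \<open>\<bar>m\<^bsup>2/3\<^esup> - n\<^bsup>2/3\<^esup>\<bar> \<ge> c N\<^bsup>-1/3\<^esup> \<bar>m - n\<bar>\<close> everything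
  is \<open>O(N\<^bsup>1/3\<^esup> log N) \<Sum> d\<^sub>3(n)\<^sup>2\<close>.  Finally \<open>\<Sum> d\<^sub>3(n)\<^sup>2 = O(N log\<^sup>8 N)\<close>, since two factorizations of
  \<open>n\<close> into three factors are the row and column products of a 3 by 3 matrix, whence
  \<open>d\<^sub>3(n)\<^sup>2 \<le> d\<^sub>9(n)\<close>.
\<close>

subsection \<open>The mean square of the divisor function\<close>

lemma dvd_mult3_decomp:
  fixes a b c d :: nat
  assumes "a dvd b * c * d"
  obtains b' c' d' where "a = b' * c' * d'" "b' dvd b" "c' dvd c" "d' dvd d"
  using assms by (metis division_decomp)

text \<open>The matrix is built row by row: \<open>a1\<close> divides the product of the
  \<open>b\<close>s, so it splits into one divisor of each. Cancelling \<open>a1\<close> (possible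
  by positivity) leaves cofactors \<open>e1\<close>, \<open>e2\<close>, \<open>e3\<close>, from
  which \<open>a2\<close> is split off in the same way; what then remains is the row of
  \<open>a3\<close>.\<close>

lemma common_refinement3:
  fixes a1 a2 a3 b1 b2 b3 :: nat
  assumes eq: "a1 * a2 * a3 = b1 * b2 * b3" and pos: "0 < a1" "0 < a2"
  obtains c11 c12 c13 c21 c22 c23 c31 c32 c33 where
    "a1 = c11 * c12 * c13" "a2 = c21 * c22 * c23" "a3 = c31 * c32 * c33"
    "b1 = c11 * c21 * c31" "b2 = c12 * c22 * c32" "b3 = c13 * c23 * c33"
proof -
  have "a1 dvd b1 * b2 * b3"
    using eq by (metis dvd_triv_left mult.assoc)
  then obtain c11 c12 c13 where a1: "a1 = c11 * c12 * c13"
    and "c11 dvd b1" "c12 dvd b2" "c13 dvd b3"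
    by (rule dvd_mult3_decomp)
  then obtain e1 e2 e3 where e: "b1 = c11 * e1" "b2 = c12 * e2" "b3 = c13 * e3"
    by (auto elim!: dvdE)
  have "a1 * (a2 * a3) = a1 * (e1 * e2 * e3)"
    using eq unfolding e a1 by (simp add: ac_simps)
  then have eq2: "a2 * a3 = e1 * e2 * e3"
    using pos by simp
  then have "a2 dvd e1 * e2 * e3"
    by (metis dvd_triv_left)
  then obtain c21 c22 c23 where a2: "a2 = c21 * c22 * c23"
    and "c21 dvd e1" "c22 dvd e2" "c23 dvd e3"
    by (rule dvd_mult3_decomp)
  then obtain c31 c32 c33 where f: "e1 = c21 * c31" "e2 = c22 * c32" "e3 = c23 * c33"
    by (auto elim!: dvdE)
  have "a2 * a3 = a2 * (c31 * c32 * c33)"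
    using eq2 unfolding f a2 by (simp add: ac_simps)
  then have a3: "a3 = c31 * c32 * c33"
    using pos by simp
  show thesis
    by (rule that[of c11 c12 c13 c21 c22 c23 c31 c32 c33]) (use a1 a2 a3 e f in \<open>simp_all add: ac_simps\<close>)
qed

text \<open>The cardinality is the summatory function of the k-fold divisor function up to
  \<open>x\<close>; a positive product forces all entries to be positive.\<close>

definition factor_lists :: "nat \<Rightarrow> nat \<Rightarrow> nat list set" where
  "factor_lists k x = {cs. length cs = k \<and> 0 < prod_list cs \<and> prod_list cs \<le> x}"

lemma factor_lists_Suc:
  "factor_lists (Suc k) x = (\<Union>c\<in>{1..x}. (#) c ` factor_lists k (x div c))"
proof (intro equalityI subsetI)
  fix cs assume "cs \<in> factor_lists (Suc k) x"
  then obtain c ds where cs: "cs = c # ds" "length ds = k" "0 < c" "0 < prod_list ds"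
      "c * prod_list ds \<le> x"
    by (auto simp: factor_lists_def length_Suc_conv)
  then have "c \<le> x"
    by (metis One_nat_def Suc_leI le_trans mult.right_neutral mult_le_mono2)
  moreover have "prod_list ds \<le> x div c"
    using cs by (simp add: less_eq_div_iff_mult_less_eq mult.commute)
  ultimately show "cs \<in> (\<Union>c\<in>{1..x}. (#) c ` factor_lists k (x div c))"
    using cs by (auto simp: factor_lists_def)
next
  fix cs assume "cs \<in> (\<Union>c\<in>{1..x}. (#) c ` factor_lists k (x div c))"
  then show "cs \<in> factor_lists (Suc k) x"
    by (auto simp: factor_lists_def less_eq_div_iff_mult_less_eq mult.commute)
qed

lemma finite_factor_lists: "finite (factor_lists k x)"
proof (induction k arbitrary: x)
  case 0
  show ?case by (rule finite_subset[of _ "{[]}"]) (auto simp: factor_lists_def)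
qed (simp add: factor_lists_Suc)

text \<open>Fixing the first factor \<open>c\<close> leaves a shorter list with product at most x/c,
  and summing 1/c over \<open>c\<close> costs one harmonic factor. A single factor costs none, so
  the exponent is one less than the length.\<close>

lemma card_factor_lists_le:
  "real (card (factor_lists (Suc k) x)) \<le> real x * harm x ^ k"
proof (induction k arbitrary: x)
  case 0
  have "factor_lists (Suc 0) x = (\<lambda>c. [c]) ` {1..x}"
    by (auto simp: factor_lists_def length_Suc_conv)
  then show ?case
    by (simp add: card_image inj_on_def)
next
  case (Suc k)
  have "card (factor_lists (Suc (Suc k)) x)
      \<le> (\<Sum>c\<in>{1..x}. card ((#) c ` factor_lists (Suc k) (x div c)))"
    by (subst factor_lists_Suc) (rule card_UN_le, simp)
  also have "\<dots> = (\<Sum>c\<in>{1..x}. card (factor_lists (Suc k) (x div c)))"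
    by (simp add: card_image)
  finally have "real (card (factor_lists (Suc (Suc k)) x))
      \<le> (\<Sum>c\<in>{1..x}. real (card (factor_lists (Suc k) (x div c))))"
    by (metis of_nat_le_iff of_nat_sum)
  also have "\<dots> \<le> (\<Sum>c\<in>{1..x}. (real x * harm x ^ k) * inverse (real c))"
  proof (rule sum_mono)
    fix c assume "c \<in> {1..x}"
    have "real (card (factor_lists (Suc k) (x div c))) \<le> real (x div c) * harm (x div c) ^ k"
      by (rule Suc.IH)
    also have "\<dots> \<le> real x / real c * harm x ^ k"
      by (intro mult_mono power_mono harm_mono of_nat_div_le_of_nat) (auto intro: harm_nonneg zero_le_power)
    finally show "real (card (factor_lists (Suc k) (x div c))) \<le> (real x * harm x ^ k) * inverse (real c)"
      by (simp add: field_simps)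
  qed
  also have "\<dots> = real x * harm x ^ Suc k"
    by (simp add: harm_def flip: sum_distrib_left)
  finally show ?case .
qed

lemma sum_d3_squared_le:
  "(\<Sum>n\<in>{1..x}. real (d3 n) ^ 2) \<le> real x * harm x ^ 8"
proof -
  define F where "F n = {(k, l, m). 0 < k \<and> 0 < l \<and> 0 < m \<and> k * l * m = (n::nat)}" for n
  define P where "P = (SIGMA n:{1..x}. F n \<times> F n)"
  \<comment> \<open>\<open>g\<close> reads nine entries as a 3 by 3 matrix, row by row, and returns
    their product, the row products and the column products. It only has to cover \<open>P\<close>,
    as an upper bound for the cardinality is enough.\<close>
  define g where "g cs = (let a = cs ! 0 * cs ! 1 * cs ! 2; b = cs ! 3 * cs ! 4 * cs ! 5;
      c = cs ! 6 * cs ! 7 * cs ! 8 in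
      (a * b * c, (a, b, c), (cs ! 0 * cs ! 3 * cs ! 6, cs ! 1 * cs ! 4 * cs ! 7, cs ! 2 * cs ! 5 * cs ! 8)))"
    for cs :: "nat list"
  have fin: "finite (F n)" if "n \<in> {1..x}" for n
  proof (rule finite_subset)
    show "F n \<subseteq> {..n} \<times> {..n} \<times> {..n}"
      by (auto simp: F_def intro!: dvd_imp_le)
  qed auto
  have "P \<subseteq> g ` factor_lists 9 x"
  proof
    fix p assume p_in: "p \<in> P"
    obtain n a1 a2 a3 b1 b2 b3 where p: "p = (n, (a1, a2, a3), (b1, b2, b3))"
      by (metis prod.collapse)
    have n: "n \<in> {1..x}" and pos: "0 < a1" "0 < a2" "0 < a3"
      and a: "a1 * a2 * a3 = n" and b: "b1 * b2 * b3 = n"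
      using p_in by (auto simp: P_def F_def p)
    have "a1 * a2 * a3 = b1 * b2 * b3"
      using a b by simp
    then obtain c11 c12 c13 c21 c22 c23 c31 c32 c33 where c:
      "a1 = c11 * c12 * c13" "a2 = c21 * c22 * c23" "a3 = c31 * c32 * c33"
      "b1 = c11 * c21 * c31" "b2 = c12 * c22 * c32" "b3 = c13 * c23 * c33"
      using pos(1,2) by (rule common_refinement3)
    let ?cs = "[c11, c12, c13, c21, c22, c23, c31, c32, c33]"
    have prod: "prod_list ?cs = n"
      unfolding a[symmetric] c by (simp add: ac_simps)
    then have "?cs \<in> factor_lists 9 x"
      using n unfolding factor_lists_def by simp
    moreover have "p = g ?cs"
      unfolding p a[symmetric] g_def Let_def c by simp
    ultimately show "p \<in> g ` factor_lists 9 x"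
      by blast
  qed
  then have "card P \<le> card (factor_lists 9 x)"
    by (rule surj_card_le[OF finite_factor_lists])
  moreover have "card P = (\<Sum>n\<in>{1..x}. d3 n ^ 2)"
    using fin by (simp add: P_def card_cartesian_product power2_eq_square d3_def F_def)
  ultimately have "(\<Sum>n\<in>{1..x}. real (d3 n) ^ 2) \<le> real (card (factor_lists 9 x))"
    by (metis (mono_tags, lifting) of_nat_le_iff of_nat_power of_nat_sum sum.cong)
  also have "\<dots> \<le> real x * harm x ^ 8"
    using card_factor_lists_le[of 8 x] by simp
  finally show ?thesis .
qed

subsection \<open>Mean values of exponential sums\<close>

lemma cmod_exp_sum_squared:
  fixes a x :: "'a \<Rightarrow> real"
  shows "cmod (\<Sum>i\<in>I. of_real (a i) * exp (\<i> * of_real (t * x i))) ^ 2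
       = (\<Sum>i\<in>I. \<Sum>j\<in>I. a i * a j * cos (t * (x i - x j)))"
proof -
  have "cmod (\<Sum>i\<in>I. of_real (a i) * exp (\<i> * of_real (t * x i))) ^ 2
      = (\<Sum>i\<in>I. a i * cos (t * x i)) ^ 2 + (\<Sum>i\<in>I. a i * sin (t * x i)) ^ 2"
    by (simp add: cmod_power2 Re_exp Im_exp)
  also have "\<dots> = (\<Sum>i\<in>I. \<Sum>j\<in>I. a i * a j * cos (t * (x i - x j)))"
    by (simp add: power2_eq_square sum_product cos_diff right_diff_distrib flip: sum.distrib)
       (simp add: algebra_simps)
  finally show ?thesis .
qed

text \<open>Instead of integrating the squared modulus \<open>f\<close>, the proof applies the mean
  value theorem to its explicit antiderivative \<open>F\<close>, which yields a point where
  \<open>f\<close> equals its average.\<close>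

lemma exp_sum_mean_value:
  fixes a x :: "'a \<Rightarrow> real" and A B :: real
  assumes inj: "inj_on x I" and fin: "finite I" and a: "\<And>i. i \<in> I \<Longrightarrow> 0 \<le> a i" and "A < B"
  obtains C where "C \<in> {A..B}"
    "(B - A) * cmod (\<Sum>i\<in>I. of_real (a i) * exp (\<i> * of_real (C * x i))) ^ 2
      \<le> (\<Sum>i\<in>I. a i ^ 2 * ((B - A) + 2 * (\<Sum>j\<in>I - {i}. 1 / \<bar>x i - x j\<bar>)))"
proof -
  define G where "G d t = (if d = 0 then t else sin (t * d) / d)" for d t :: real
  define F where "F t = (\<Sum>i\<in>I. \<Sum>j\<in>I. a i * a j * G (x i - x j) t)" for t
  define f where "f t = (\<Sum>i\<in>I. \<Sum>j\<in>I. a i * a j * cos (t * (x i - x j)))" for t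
  have G': "(G d has_real_derivative cos (t * d)) (at t)" for d t
    by (cases "d = 0") (auto simp: G_def[abs_def] intro!: derivative_eq_intros)
  have F': "(F has_real_derivative f t) (at t)" for t
    unfolding F_def[abs_def] f_def by (intro DERIV_sum DERIV_cmult G')
  from MVT2[OF \<open>A < B\<close> F'] obtain C where C: "A < C" "C < B" "F B - F A = (B - A) * f C"
    by blast
  have G_diff: "G d B - G d A \<le> 2 / \<bar>d\<bar>" if "d \<noteq> 0" for d
  proof -
    have "\<bar>sin (B * d) - sin (A * d)\<bar> \<le> 2"
      using abs_sin_le_one[of "B * d"] abs_sin_le_one[of "A * d"] by linarith
    then have "\<bar>(sin (B * d) - sin (A * d)) / d\<bar> \<le> 2 / \<bar>d\<bar>"
      by (simp add: abs_divide divide_right_mono)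
    then show ?thesis
      using that by (simp add: G_def diff_divide_distrib)
  qed
  \<comment> \<open>By convention \<open>1 / 0 = 0\<close>, so \<open>h i i = 0\<close>.\<close>
  define h where "h i j = 1 / \<bar>x i - x j\<bar>" for i j
  have "(B - A) * f C = (\<Sum>i\<in>I. \<Sum>j\<in>I. a i * a j * (G (x i - x j) B - G (x i - x j) A))"
    by (simp add: C(3)[symmetric] F_def sum_subtractf right_diff_distrib)
  \<comment> \<open>The \<open>if\<close> term is the diagonal; the rest is AM-GM, 2uv <= u^2 + v^2.
    Writing the last term with \<open>h j i\<close> makes the two double sums equal after
    interchanging the summations.\<close>
  also have "\<dots> \<le> (\<Sum>i\<in>I. \<Sum>j\<in>I. (if j = i then a i ^ 2 * (B - A) else 0)
      + (a i ^ 2 * h i j + a j ^ 2 * h j i))"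
  proof (intro sum_mono)
    fix i j assume ij: "i \<in> I" "j \<in> I"
    show "a i * a j * (G (x i - x j) B - G (x i - x j) A) \<le>
        (if j = i then a i ^ 2 * (B - A) else 0) + (a i ^ 2 * h i j + a j ^ 2 * h j i)"
    proof (cases "i = j")
      case False
      then have "x i - x j \<noteq> 0"
        using inj ij by (auto dest: inj_onD)
      then have "a i * a j * (G (x i - x j) B - G (x i - x j) A) \<le> a i * a j * (2 / \<bar>x i - x j\<bar>)"
        by (intro mult_left_mono G_diff) (use a ij in auto)
      also have "\<dots> = (2 * a i * a j) * (1 / \<bar>x i - x j\<bar>)"
        by simp
      also have "\<dots> \<le> (a i ^ 2 + a j ^ 2) * (1 / \<bar>x i - x j\<bar>)"
        by (intro mult_right_mono sum_squares_bound) auto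
      finally show ?thesis
        using False by (simp add: h_def add_divide_distrib abs_minus_commute)
    qed (simp add: G_def h_def power2_eq_square)
  qed
  also have "\<dots> = (\<Sum>i\<in>I. a i ^ 2 * (B - A)) + ((\<Sum>i\<in>I. \<Sum>j\<in>I. a i ^ 2 * h i j) + (\<Sum>i\<in>I. \<Sum>j\<in>I. a j ^ 2 * h j i))"
    using fin by (simp add: sum.distrib)
  also have "(\<Sum>i\<in>I. \<Sum>j\<in>I. a j ^ 2 * h j i) = (\<Sum>i\<in>I. \<Sum>j\<in>I. a i ^ 2 * h i j)"
    by (rule sum.swap)
  also have "(\<Sum>i\<in>I. \<Sum>j\<in>I. a i ^ 2 * h i j) = (\<Sum>i\<in>I. a i ^ 2 * (\<Sum>j\<in>I - {i}. 1 / \<bar>x i - x j\<bar>))"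
    using fin by (intro sum.cong refl) (simp add: sum.remove h_def sum_distrib_left)
  finally have "(B - A) * f C \<le> (\<Sum>i\<in>I. a i ^ 2 * ((B - A) + 2 * (\<Sum>j\<in>I - {i}. 1 / \<bar>x i - x j\<bar>)))"
    by (simp add: sum.distrib distrib_left sum_distrib_left ac_simps)
  then show thesis
    using that[of C] C(1,2) by (simp add: cmod_exp_sum_squared f_def del: of_real_mult)
qed

subsection \<open>Spacing of the frequencies\<close>

text \<open>By the mean value theorem, since the derivative of t^(2/3) is decreasing and hence at
  least its value at \<open>M\<close>.\<close>

lemma powr_two_thirds_spacing:
  fixes u v M :: real
  assumes "0 < u" "u < v" "v \<le> M"
  shows "(2/3) * M powr (-1/3) * (v - u) \<le> v powr (2/3) - u powr (2/3)"
proof -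
  have "\<exists>z. u < z \<and> z < v \<and> v powr (2/3) - u powr (2/3) = (v - u) * ((2/3) * z powr (-1/3))"
  proof (rule MVT2[OF \<open>u < v\<close>])
    fix z assume "u \<le> z" "z \<le> v"
    then show "((\<lambda>t. t powr (2/3)) has_real_derivative (2/3) * z powr (-1/3)) (at z)"
      using assms by (auto intro!: derivative_eq_intros)
  qed
  then obtain z where z: "u < z" "z < v"
    and eq: "v powr (2/3) - u powr (2/3) = (v - u) * ((2/3) * z powr (-1/3))"
    by blast
  have "M powr (-1/3) \<le> z powr (-1/3)"
    by (rule powr_mono2') (use assms z in auto)
  then show ?thesis
    using assms by (simp add: eq mult.commute)
qed

lemma inverse_powr_two_thirds_spacing:
  fixes u v M :: real
  assumes "0 < u" "u \<le> M" "0 < v" "v \<le> M" "u \<noteq> v"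
  shows "1 / \<bar>u powr (2/3) - v powr (2/3)\<bar> \<le> (3/2) * M powr (1/3) * (1 / \<bar>u - v\<bar>)"
proof -
  have *: "(2/3) * M powr (-1/3) * \<bar>u - v\<bar> \<le> \<bar>u powr (2/3) - v powr (2/3)\<bar>"
    using powr_two_thirds_spacing[of u v M] powr_two_thirds_spacing[of v u M] assms
    by (cases "u < v") (auto simp: abs_if)
  have pos: "0 < (2/3) * M powr (-1/3) * \<bar>u - v\<bar>"
    using assms by auto
  have "1 / \<bar>u powr (2/3) - v powr (2/3)\<bar> \<le> 1 / ((2/3) * M powr (-1/3) * \<bar>u - v\<bar>)"
    by (rule divide_left_mono[OF *]) (use pos * in \<open>simp_all only: zero_le_one mult_pos_pos less_le_trans[OF pos *]\<close>)
  also have "\<dots> = (3/2) * M powr (1/3) * (1 / \<bar>u - v\<bar>)"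
    by (simp add: powr_minus_divide)
  finally show ?thesis .
qed

text \<open>The sequence \<open>harm n - ln n\<close> is decreasing and starts at 1.\<close>

lemma harm_le_ln: "1 \<le> n \<Longrightarrow> harm n \<le> 1 + ln (real n)"
  using euler_mascheroni_sequence_decreasing[of 1 n] by (simp add: harm_def)

text \<open>On either side of \<open>n\<close> the distances run through consecutive integers from
  1, fewer than \<open>M\<close> of them, so each side is a harmonic number.\<close>

lemma sum_inverse_dist_le_harm:
  fixes n N M :: nat
  assumes "n \<in> {N<..N + M}"
  shows "(\<Sum>m\<in>{N<..N + M} - {n}. 1 / \<bar>real n - real m\<bar>) \<le> 2 * harm M"
proof -
  have "{N<..N + M} - {n} = {N<..<n} \<union> {n<..N + M}"
    using assms by auto
  moreover have "{N<..<n} \<inter> {n<..N + M} = {}"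
    by auto
  ultimately have "(\<Sum>m\<in>{N<..N + M} - {n}. 1 / \<bar>real n - real m\<bar>)
      = (\<Sum>m\<in>{N<..<n}. 1 / \<bar>real n - real m\<bar>) + (\<Sum>m\<in>{n<..N + M}. 1 / \<bar>real n - real m\<bar>)"
    by (simp only: sum.union_disjoint finite_greaterThanLessThan finite_greaterThanAtMost)
  also have "(\<Sum>m\<in>{N<..<n}. 1 / \<bar>real n - real m\<bar>) = (\<Sum>k\<in>{1..n - N - 1}. inverse (real k))"
    by (rule sum.reindex_bij_witness[of _ "\<lambda>k. n - k" "\<lambda>m. n - m"])
       (auto simp: of_nat_diff divide_simps)
  also have "(\<Sum>m\<in>{n<..N + M}. 1 / \<bar>real n - real m\<bar>) = (\<Sum>k\<in>{1..N + M - n}. inverse (real k))"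
    by (rule sum.reindex_bij_witness[of _ "\<lambda>k. n + k" "\<lambda>m. m - n"])
       (auto simp: of_nat_diff divide_simps)
  finally have "(\<Sum>m\<in>{N<..N + M} - {n}. 1 / \<bar>real n - real m\<bar>) = harm (n - N - 1) + harm (N + M - n)"
    by (simp add: harm_def)
  moreover have "harm (n - N - 1) \<le> (harm M :: real)" "harm (N + M - n) \<le> (harm M :: real)"
    using assms by (auto intro!: harm_mono)
  ultimately show ?thesis
    by linarith
qed

theorem theorem2:
  fixes A B :: real
  assumes "0 < A" and "A < B"
  shows "\<exists>K>0. \<forall>N::nat. \<forall>N'::real. 2 \<le> N \<and> real N < N' \<and> N' \<le> 2 * real N \<longrightarrow>
    (\<exists>C\<in>{A..B}. cmod (S C N N') \<le> K * real N powr (2/3) * ln (real N) powr (9/2))"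
proof -
  \<comment> \<open>The factor 2 * 4^8 comes from the mean square of \<open>d3\<close> up to 2N, the
    last factor from \<open>weight\<close> after division by B - A.\<close>
  define L where "L = 2 * 4 ^ 8 * (2 + 36 / (B - A))"
  have L: "0 < L"
    using \<open>A < B\<close> by (simp add: L_def add_pos_pos)
  have "\<exists>C\<in>{A..B}. cmod (S C N N') \<le> sqrt L * real N powr (2/3) * ln (real N) powr (9/2)"
    if N: "2 \<le> N" and N': "real N < N'" "N' \<le> 2 * real N" for N :: nat and N' :: real
  proof -
    define l where "l = ln (real N)"
    define I where "I = {n. N < n \<and> real n \<le> N'}"
    define x where "x n = real n powr (2/3)" for n
    define q where "q = real N powr (1/3)"
    have sub: "I \<subseteq> {N<..N + N}"
      using N' by (auto simp: I_def)
    then have fin: "finite I"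
      by (rule finite_subset) simp
    have inj: "inj_on x I"
      by (auto simp: inj_on_def x_def dest: arg_cong[where f = "\<lambda>y. y powr (3/2)"] simp: powr_powr)
    obtain C where C: "C \<in> {A..B}"
      and le: "(B - A) * cmod (\<Sum>n\<in>I. of_real (real (d3 n)) * exp (\<i> * of_real (C * x n))) ^ 2
        \<le> (\<Sum>n\<in>I. real (d3 n) ^ 2 * ((B - A) + 2 * (\<Sum>m\<in>I - {n}. 1 / \<bar>x n - x m\<bar>)))"
      using exp_sum_mean_value[OF inj fin _ \<open>A < B\<close>, of "\<lambda>n. real (d3 n)"] by auto
    \<comment> \<open>As N >= 2 keeps the logarithm away from 0, additive constants can be absorbed
      into multiples of \<open>l\<close>.\<close>
    have l: "1 \<le> 2 * l"
    proof -
      have "ln 2 \<le> l"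
        using N by (simp add: l_def)
      then show ?thesis
        using ln2_ge_two_thirds by linarith
    qed
    have q: "1 \<le> q"
      using N by (simp add: q_def ge_one_powr_ge_zero)
    have harm_N: "harm N \<le> 3 * l"
      using harm_le_ln[of N] N l by (simp add: l_def)
    have "harm (N + N) \<le> 1 + (ln 2 + l)"
      using harm_le_ln[of "N + N"] N by (simp add: l_def ln_mult flip: mult_2)
    moreover have "ln 2 \<le> l"
      using N by (simp add: l_def)
    ultimately have harm_2N: "harm (N + N) \<le> 4 * l"
      using l by linarith
    \<comment> \<open>Here 18 = 3 * 2 * 3: the spacing constant with 2^(1/3) <= 2, the two sides of
      \<open>n\<close>, and \<open>harm_N\<close>.\<close>
    have inner: "(\<Sum>m\<in>I - {n}. 1 / \<bar>x n - x m\<bar>) \<le> 18 * q * l" if n: "n \<in> I" for n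
    proof -
      have "(2::real) powr (1/3) \<le> 2 powr 1"
        by (rule powr_mono) auto
      then have two_N: "(3/2) * (2 * real N) powr (1/3) \<le> 3 * q"
        using mult_left_mono[of "2 powr (1/3)" 2 "real N powr (1/3)"] by (simp add: q_def powr_mult mult.commute)
      have "(\<Sum>m\<in>I - {n}. 1 / \<bar>x n - x m\<bar>) \<le> (\<Sum>m\<in>I - {n}. 3 * q * (1 / \<bar>real n - real m\<bar>))"
      proof (rule sum_mono)
        fix m assume m: "m \<in> I - {n}"
        have "1 / \<bar>x n - x m\<bar> \<le> (3/2) * (2 * real N) powr (1/3) * (1 / \<bar>real n - real m\<bar>)"
          unfolding x_def
          by (rule inverse_powr_two_thirds_spacing) (use m n N' in \<open>auto simp: I_def\<close>)
        also have "\<dots> \<le> 3 * q * (1 / \<bar>real n - real m\<bar>)"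
          by (rule mult_right_mono[OF two_N]) simp
        finally show "1 / \<bar>x n - x m\<bar> \<le> 3 * q * (1 / \<bar>real n - real m\<bar>)" .
      qed
      also have "\<dots> = 3 * q * (\<Sum>m\<in>I - {n}. 1 / \<bar>real n - real m\<bar>)"
        by (simp add: sum_distrib_left)
      also have "\<dots> \<le> 3 * q * (\<Sum>m\<in>{N<..N + N} - {n}. 1 / \<bar>real n - real m\<bar>)"
        using sub q by (intro mult_left_mono sum_mono2) auto
      also have "\<dots> \<le> 3 * q * (2 * (3 * l))"
        using sum_inverse_dist_le_harm[of n N N] sub n q harm_N by (intro mult_left_mono) auto
      finally show ?thesis
        by simp
    qed
    \<comment> \<open>The diagonal term B - A is absorbed through 1 <= 2ql, and 36 is twice the
      constant of \<open>inner\<close>.\<close>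
    have weight: "(B - A) + 2 * (\<Sum>m\<in>I - {n}. 1 / \<bar>x n - x m\<bar>) \<le> (2 * (B - A) + 36) * (q * l)"
      if n: "n \<in> I" for n
    proof -
      have "1 * 1 \<le> q * (2 * l)"
        using q l by (intro mult_mono) auto
      then have "(B - A) * 1 \<le> (B - A) * (2 * (q * l))"
        using \<open>A < B\<close> by (intro mult_left_mono) auto
      then show ?thesis
        using inner[OF n] by (simp add: algebra_simps)
    qed
    have "(\<Sum>n\<in>I. real (d3 n) ^ 2) \<le> (\<Sum>n\<in>{1..N + N}. real (d3 n) ^ 2)"
      using sub by (intro sum_mono2) auto
    also have "\<dots> \<le> real (N + N) * harm (N + N) ^ 8"
      by (rule sum_d3_squared_le)
    also have "\<dots> \<le> real (N + N) * (4 * l) ^ 8"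
      using harm_2N by (intro mult_left_mono power_mono harm_nonneg) auto
    also have "\<dots> = 2 * 4 ^ 8 * (real N * l ^ 8)"
      by (simp add: power_mult_distrib)
    finally have sq: "(\<Sum>n\<in>I. real (d3 n) ^ 2) \<le> 2 * 4 ^ 8 * (real N * l ^ 8)" .
    have "cmod (\<Sum>n\<in>I. of_real (real (d3 n)) * exp (\<i> * of_real (C * x n))) = cmod (S C N N')"
      by (simp add: S_def I_def x_def)
    then have "(B - A) * cmod (S C N N') ^ 2
        \<le> (\<Sum>n\<in>I. real (d3 n) ^ 2 * ((B - A) + 2 * (\<Sum>m\<in>I - {n}. 1 / \<bar>x n - x m\<bar>)))"
      using le by simp
    also have "\<dots> \<le> (\<Sum>n\<in>I. real (d3 n) ^ 2 * ((2 * (B - A) + 36) * (q * l)))"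
      by (intro sum_mono mult_left_mono weight) auto
    also have "\<dots> = (\<Sum>n\<in>I. real (d3 n) ^ 2) * ((2 * (B - A) + 36) * (q * l))"
      by (simp add: sum_distrib_right)
    also have "\<dots> \<le> (2 * 4 ^ 8 * (real N * l ^ 8)) * ((2 * (B - A) + 36) * (q * l))"
      using \<open>A < B\<close> q l by (intro mult_right_mono sq) auto
    also have "\<dots> = (B - A) * (L * ((real N * q) * l ^ 9))"
      using \<open>A < B\<close> by (simp add: L_def field_simps eval_nat_numeral)
    finally have "cmod (S C N N') ^ 2 \<le> L * ((real N * q) * l ^ 9)"
      using \<open>A < B\<close> by simp
    \<comment> \<open>Of the nine logarithms, eight come from the divisor function and one from the
      spacing sum; N * q = N^(4/3) is the square of N^(2/3).\<close>
    also have "\<dots> = (sqrt L * real N powr (2/3) * l powr (9/2)) ^ 2"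
    proof -
      have "real N * q = (real N powr (2/3)) ^ 2"
        using N by (simp add: q_def powr_power powr_mult_base)
      moreover have "l ^ 9 = (l powr (9/2)) ^ 2"
        using l by (simp add: powr_power)
      ultimately show ?thesis
        using L by (simp add: power_mult_distrib)
    qed
    finally have "cmod (S C N N') \<le> sqrt L * real N powr (2/3) * l powr (9/2)"
      by (rule power2_le_imp_le) (use L in simp)
    then show ?thesis
      using C unfolding l_def by blast
  qed
  then show ?thesis
    using L by (intro exI[of _ "sqrt L"]) auto
qed

end
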